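(* Let $\tau$ be a sequentially compact topology on a set $X$. Then there is a sequentially compact topology $\tau''$ on $X$ with $\tau\subseteq\tau''$ that is maximal (with respect to inclusion) among the sequentially compact topologies on $X$.
   Context: A topological space is called sequentially compact if each of its sequences has a convergent subsequence; no separation axiom is assumed. Maximality of $\tau''$ means that $\tau''$ is not strictly contained in any sequentially compact topology on $X$. *)

theory Defs
  imports "HOL-Analysis.Analysis"
begin

(* Counterpart, for abstract topologies on topspace T, of the type-class notion seq_compact. *)
definition seq_compact_space :: "'a topology \<Rightarrow> bool" where
  "seq_compact_space T \<longleftrightarrow>
     (\<forall>s :: nat \<Rightarrow> 'a. range s \<subseteq> topspace T \<longrightarrow>
        (\<exists>l r. strict_mono (r :: nat \<Rightarrow> nat) \<and> limitin T (s \<circ> r) l sequentially))"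

definition opens_of :: "'a topology \<Rightarrow> 'a set set" where
  "opens_of T = {U. openin T U}"

definition maximal_seq_compact :: "'a set \<Rightarrow> 'a topology \<Rightarrow> bool" where
  "maximal_seq_compact X T \<longleftrightarrow>
     topspace T = X \<and> seq_compact_space T \<and>
     \<not> (\<exists>S. topspace S = X \<and> seq_compact_space S \<and> opens_of T \<subset> opens_of S)"

end

theory Submission
  imports Defs
begin

text \<open>
  A refinement can be produced by deciding, once and for all, where sequences shall converge.
  Regard an injective sequence as its infinite range \<open>A\<close>, so that convergence to \<open>l\<close> says that
  every neighbourhood of \<open>l\<close> contains all but finitely many points of \<open>A\<close>.  Among the infinite
  sets that converge in \<open>\<tau>\<close>, choose a maximal almost disjoint family \<open>\<A>\<close>, and choose for each
  \<open>A \<in> \<A>\<close> a single one of its \<open>\<tau>\<close>-limits, \<open>lp A\<close>.  Let \<open>\<tau>''\<close> be the finest topology in which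
  every \<open>A \<in> \<A>\<close> still converges to \<open>lp A\<close>.

  It refines \<open>\<tau>\<close> because the chosen limits are \<open>\<tau>\<close>-limits.  It is sequentially compact because,
  by maximality of \<open>\<A>\<close>, the range of a \<open>\<tau>\<close>-convergent sequence without constant subsequence
  meets some \<open>A \<in> \<A>\<close> in an infinite set, and the terms in \<open>A\<close> converge to \<open>lp A\<close>.

  It is maximal because almost disjointness makes \<open>\<tau>''\<close> rich in closed sets: any part of \<open>A\<close>
  together with \<open>lp A\<close> is closed, since every other member of \<open>\<A>\<close> meets it in a finite set only.
  If \<open>U\<close> were open in a sequentially compact refinement but not in \<open>\<tau>''\<close>, then for some \<open>A\<close> the
  set \<open>A - U\<close> would be infinite although \<open>lp A \<in> U\<close>.  A sequence running through \<open>A - U\<close> would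
  cluster in the refinement at some \<open>m \<notin> U\<close>, and the closed set
  \<open>insert (lp A) (A - U) - {m}\<close> forbids that.
\<close>

definition almost_disjoint :: "'a set set \<Rightarrow> bool" where
  "almost_disjoint \<A> \<longleftrightarrow> (\<forall>A\<in>\<A>. \<forall>B\<in>\<A>. A \<noteq> B \<longrightarrow> finite (A \<inter> B))"

text \<open>The infinite case of \<open>A\<close> is the intended one: then this is the convergence of every
  injective enumeration of a countably infinite subset of \<open>A\<close>.\<close>

definition set_converges :: "'a topology \<Rightarrow> 'a set \<Rightarrow> 'a \<Rightarrow> bool" where
  "set_converges T A l \<longleftrightarrow>
     l \<in> topspace T \<and> (\<forall>U. openin T U \<and> l \<in> U \<longrightarrow> finite (A - U))"

definition finest_converging :: "'a set \<Rightarrow> 'a set set \<Rightarrow> ('a set \<Rightarrow> 'a) \<Rightarrow> 'a topology" where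
  "finest_converging X \<A> lp =
     topology (\<lambda>U. U \<subseteq> X \<and> (\<forall>A\<in>\<A>. lp A \<in> U \<longrightarrow> finite (A - U)))"

lemma openin_finest_converging:
  "openin (finest_converging X \<A> lp) U \<longleftrightarrow>
     U \<subseteq> X \<and> (\<forall>A\<in>\<A>. lp A \<in> U \<longrightarrow> finite (A - U))"
proof -
  have "istopology (\<lambda>U. U \<subseteq> X \<and> (\<forall>A\<in>\<A>. lp A \<in> U \<longrightarrow> finite (A - U)))"
    unfolding istopology_def
  proof (intro conjI allI impI)
    fix S T assume S: "S \<subseteq> X \<and> (\<forall>A\<in>\<A>. lp A \<in> S \<longrightarrow> finite (A - S))"
      and T: "T \<subseteq> X \<and> (\<forall>A\<in>\<A>. lp A \<in> T \<longrightarrow> finite (A - T))"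
    show "S \<inter> T \<subseteq> X" using S by blast
    show "\<forall>A\<in>\<A>. lp A \<in> S \<inter> T \<longrightarrow> finite (A - S \<inter> T)"
      using S T by (simp add: Diff_Int)
  next
    fix K assume K: "\<forall>S\<in>K. S \<subseteq> X \<and> (\<forall>A\<in>\<A>. lp A \<in> S \<longrightarrow> finite (A - S))"
    show "\<Union>K \<subseteq> X" using K by blast
    show "\<forall>A\<in>\<A>. lp A \<in> \<Union>K \<longrightarrow> finite (A - \<Union>K)"
    proof (intro ballI impI)
      fix A assume "A \<in> \<A>" "lp A \<in> \<Union>K"
      then obtain S where "S \<in> K" "finite (A - S)" using K by blast
      then show "finite (A - \<Union>K)" by (blast intro: finite_subset[of _ "A - S"])
    qed
  qed
  then show ?thesis by (simp add: finest_converging_def)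
qed

lemma topspace_finest_converging:
  assumes "\<And>A. A \<in> \<A> \<Longrightarrow> A \<subseteq> X"
  shows "topspace (finest_converging X \<A> lp) = X"
proof (rule antisym)
  show "topspace (finest_converging X \<A> lp) \<subseteq> X"
    using openin_topspace[of "finest_converging X \<A> lp"]
    unfolding openin_finest_converging by blast
  have "finite (A - X)" if "A \<in> \<A>" for A
  proof -
    have "A - X = {}" using assms[OF that] by blast
    then show ?thesis by (simp only: finite.emptyI)
  qed
  then have "openin (finest_converging X \<A> lp) X"
    by (simp add: openin_finest_converging)
  then show "X \<subseteq> topspace (finest_converging X \<A> lp)" by (rule openin_subset)
qed

text \<open>Almost disjointness is preserved by unions of chains, being a condition on pairs; and a set
  of \<open>\<F>\<close> that met each member of a maximal family finitely could be added to it.\<close>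

lemma maximal_almost_disjoint_subfamily:
  assumes inf: "\<And>B. B \<in> \<F> \<Longrightarrow> infinite B"
  obtains \<A> where "\<A> \<subseteq> \<F>" "almost_disjoint \<A>"
    "\<And>B. B \<in> \<F> \<Longrightarrow> \<exists>A\<in>\<A>. infinite (B \<inter> A)"
proof -
  let ?P = "{\<A>. \<A> \<subseteq> \<F> \<and> almost_disjoint \<A>}"
  have "\<exists>M\<in>?P. \<forall>Z\<in>?P. M \<subseteq> Z \<longrightarrow> Z = M"
  proof (rule subset_Zorn_nonempty)
    show "?P \<noteq> {}" by (auto simp: almost_disjoint_def)
  next
    fix C assume C: "subset.chain ?P C"
    have "finite (A \<inter> B)" if "\<D> \<in> C" "A \<in> \<D>" "\<E> \<in> C" "B \<in> \<E>" "A \<noteq> B" for A B \<D> \<E>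
    proof -
      have chain: "\<D> \<subseteq> \<E> \<or> \<E> \<subseteq> \<D>"
        using C that(1,3) unfolding subset_chain_def by blast
      have "almost_disjoint \<D>" "almost_disjoint \<E>"
        using C that(1,3) unfolding subset_chain_def by blast+
      moreover have "A \<in> \<D> \<and> B \<in> \<D> \<or> A \<in> \<E> \<and> B \<in> \<E>"
        using chain that(2,4) by (elim disjE) (simp_all add: subsetD)
      ultimately show ?thesis using that(5) by (auto simp: almost_disjoint_def)
    qed
    then have "almost_disjoint (\<Union>C)" unfolding almost_disjoint_def by blast
    moreover have "\<Union>C \<subseteq> \<F>" using C by (auto simp: subset_chain_def)
    ultimately show "\<Union>C \<in> ?P" by simp
  qed
  then obtain \<A> where A: "\<A> \<subseteq> \<F>" "almost_disjoint \<A>"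
    and max: "\<And>Z. Z \<subseteq> \<F> \<Longrightarrow> almost_disjoint Z \<Longrightarrow> \<A> \<subseteq> Z \<Longrightarrow> Z = \<A>" by auto
  have "\<exists>A\<in>\<A>. infinite (B \<inter> A)" if B: "B \<in> \<F>" for B
  proof (rule ccontr)
    assume *: "\<not> ?thesis"
    then have "almost_disjoint (insert B \<A>)"
      using A(2) by (auto simp: almost_disjoint_def Int_commute)
    then have "B \<in> \<A>" using max[of "insert B \<A>"] A(1) B by blast
    then show False using * inf[OF B] by auto
  qed
  with A show ?thesis using that by blast
qed

text \<open>A convergent subsequence in \<open>T\<close> either repeats a value infinitely often or has finite fibres.
  In the second case its range is an infinite convergent set, so infinitely many of its terms lie
  in one \<open>A \<in> \<A>\<close>, and finiteness of the fibres turns a statement about all but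
  finitely many points of \<open>A\<close> into one about all but finitely many terms.\<close>

lemma seq_compact_space_finest_converging:
  assumes sc: "seq_compact_space T"
    and sub: "\<And>A. A \<in> \<A> \<Longrightarrow> A \<subseteq> topspace T"
    and lp: "\<And>A. A \<in> \<A> \<Longrightarrow> lp A \<in> topspace T"
    and meet: "\<And>B l. infinite B \<Longrightarrow> B \<subseteq> topspace T \<Longrightarrow> set_converges T B l \<Longrightarrow>
                 \<exists>A\<in>\<A>. infinite (B \<inter> A)"
  shows "seq_compact_space (finest_converging (topspace T) \<A> lp)"
  unfolding seq_compact_space_def
proof (intro allI impI)
  let ?T = "finest_converging (topspace T) \<A> lp"
  have top: "topspace ?T = topspace T" by (rule topspace_finest_converging[OF sub])
  fix s :: "nat \<Rightarrow> 'a" assume "range s \<subseteq> topspace ?T"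
  then have s: "range s \<subseteq> topspace T" by (simp add: top)
  then obtain l r where r: "strict_mono r" and l: "limitin T (s \<circ> r) l sequentially"
    using sc unfolding seq_compact_space_def by blast
  define t where "t = s \<circ> r"
  have t: "range t \<subseteq> topspace T" using s by (auto simp: t_def)
  have "\<exists>l q. strict_mono q \<and> limitin ?T (t \<circ> q) l sequentially"
  proof (cases "\<exists>v. infinite {n. t n = v}")
    case True
    then obtain v where v: "infinite {n. t n = v}" by blast
    then obtain q :: "nat \<Rightarrow> nat" where q: "strict_mono q" "\<And>n. t (q n) = v"
      using infinite_enumerate[OF v] by auto
    have "v \<in> topspace T" using t q(2)[of 0] by blast
    then have "limitin ?T (t \<circ> q) v sequentially"
      by (simp add: limitin_def q(2) top)
    with q(1) show ?thesis by blast
  next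
    case False
    have fin: "finite {n. t n \<in> F}" if "finite F" for F
    proof -
      have "{n. t n \<in> F} = (\<Union>v\<in>F. {n. t n = v})" by blast
      with False that show ?thesis by simp
    qed
    have "infinite (range t)" using fin[of "range t"] by auto
    moreover have "set_converges T (range t) l"
      unfolding set_converges_def
    proof (intro conjI allI impI)
      show "l \<in> topspace T" using l by (simp add: limitin_def)
      fix U assume "openin T U \<and> l \<in> U"
      then have "eventually (\<lambda>n. t n \<in> U) sequentially"
        using l unfolding limitin_def t_def by blast
      then obtain N where "\<And>n. n \<ge> N \<Longrightarrow> t n \<in> U"
        unfolding eventually_sequentially by blast
      then have "n < N" if "t n \<notin> U" for n using that not_less by blast
      then have "range t - U \<subseteq> t ` {..<N}" by blast
      then show "finite (range t - U)" using finite_subset by blast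
    qed
    ultimately obtain A where A: "A \<in> \<A>" "infinite (range t \<inter> A)"
      using meet t by blast
    have "infinite {n. t n \<in> A}"
    proof
      assume "finite {n. t n \<in> A}"
      then have "finite (t ` {n. t n \<in> A})" by simp
      moreover have "t ` {n. t n \<in> A} = range t \<inter> A" by blast
      ultimately show False using A(2) by simp
    qed
    then obtain q :: "nat \<Rightarrow> nat" where q: "strict_mono q" "\<And>n. t (q n) \<in> A"
      using infinite_enumerate[of "{n. t n \<in> A}"] by auto
    have "limitin ?T (t \<circ> q) (lp A) sequentially"
      unfolding limitin_def top
    proof (intro conjI allI impI)
      show "lp A \<in> topspace T" using lp A(1) .
      fix U assume "openin ?T U \<and> lp A \<in> U"
      then have "finite (A - U)" using A(1) by (simp add: openin_finest_converging)
      then have "finite {n. t n \<in> A - U}" by (rule fin)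
      then have "finite (q -` {n. t n \<in> A - U})"
        using q(1) by (intro finite_vimageI) (auto intro: strict_mono_imp_inj_on)
      moreover have "q -` {n. t n \<in> A - U} = {n. \<not> (t \<circ> q) n \<in> U}"
        using q(2) by auto
      ultimately show "eventually (\<lambda>n. (t \<circ> q) n \<in> U) sequentially"
        by (simp add: cofinite_eq_sequentially[symmetric] eventually_cofinite)
    qed
    with q(1) show ?thesis by blast
  qed
  then obtain l' q where "strict_mono q" "limitin ?T (t \<circ> q) l' sequentially" by blast
  then show "\<exists>l r. strict_mono r \<and> limitin ?T (s \<circ> r) l sequentially"
    using strict_mono_o[OF r, of q] unfolding t_def comp_assoc by blast
qed

text \<open>Every \<open>B \<noteq> A\<close> in the family has only finitely many points in \<open>C\<close>, so only \<open>A\<close> could force a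
  point outside \<open>C\<close> into the closure of \<open>C\<close>; but its chosen limit already lies in \<open>C\<close>.\<close>

lemma openin_finest_converging_Diff:
  assumes ad: "almost_disjoint \<A>" and sub: "\<And>B. B \<in> \<A> \<Longrightarrow> B \<subseteq> X"
    and A: "A \<in> \<A>" and C: "lp A \<in> C" "C \<subseteq> insert (lp A) A"
  shows "openin (finest_converging X \<A> lp) (X - C)"
  unfolding openin_finest_converging
proof (intro conjI ballI impI)
  fix B assume B: "B \<in> \<A>" "lp B \<in> X - C"
  then have "B \<noteq> A" using C(1) by blast
  then have "finite (insert (lp A) (A \<inter> B))"
    using ad A B(1) by (simp add: almost_disjoint_def)
  moreover have "B - (X - C) \<subseteq> insert (lp A) (A \<inter> B)" using sub[OF B(1)] C(2) by blast
  ultimately show "finite (B - (X - C))" by (rule rev_finite_subset)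
qed blast

text \<open>A new open set would keep infinitely many points of some \<open>A\<close> away from \<open>lp A\<close>.  They would
  need a cluster point \<open>m \<noteq> lp A\<close>, while all these points except possibly \<open>m\<close> lie in a set that
  does not contain \<open>m\<close> and is closed already in the coarser topology.\<close>

lemma no_finer_seq_compact_space:
  assumes ad: "almost_disjoint \<A>" and sub: "\<And>A. A \<in> \<A> \<Longrightarrow> A \<subseteq> X"
    and S: "topspace S = X" "seq_compact_space S"
    and finer: "opens_of (finest_converging X \<A> lp) \<subseteq> opens_of S"
  shows "opens_of S \<subseteq> opens_of (finest_converging X \<A> lp)"
proof
  fix U assume "U \<in> opens_of S"
  then have U: "openin S U" "U \<subseteq> X" using openin_subset S(1) by (auto simp: opens_of_def)
  have "finite (A - U)" if A: "A \<in> \<A>" and lp: "lp A \<in> U" for A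
  proof (rule ccontr)
    assume "infinite (A - U)"
    then obtain s :: "nat \<Rightarrow> 'a" where s: "inj s" "range s \<subseteq> A - U"
      using infinite_countable_subset by blast
    then have "range s \<subseteq> topspace S" using sub[OF A] S(1) by blast
    then obtain m r where r: "strict_mono r" and m: "limitin S (s \<circ> r) m sequentially"
      using S(2) unfolding seq_compact_space_def by blast
    have mX: "m \<in> X" using m S(1) by (simp add: limitin_def)
    have mU: "m \<notin> U"
    proof
      assume "m \<in> U"
      then have "eventually (\<lambda>n. (s \<circ> r) n \<in> U) sequentially"
        using m U(1) by (simp add: limitin_def)
      then obtain n where "(s \<circ> r) n \<in> U" by (auto simp: eventually_sequentially)
      then show False using s(2) by auto
    qed
    \<comment> \<open>\<open>m\<close> may itself be a term of the sequence, hence its removal; \<open>lp A\<close> survives it because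
      \<open>m \<notin> U\<close>.\<close>
    let ?C = "insert (lp A) (A - U) - {m}"
    have "openin (finest_converging X \<A> lp) (X - ?C)"
      using lp mU by (intro openin_finest_converging_Diff[OF ad sub A]) auto
    then have "openin S (X - ?C)" using finer by (auto simp: opens_of_def)
    then have "eventually (\<lambda>n. (s \<circ> r) n \<in> X - ?C) sequentially"
      using m mX unfolding limitin_def by blast
    then obtain N where N: "\<And>n. n \<ge> N \<Longrightarrow> (s \<circ> r) n \<in> X - ?C"
      unfolding eventually_sequentially by blast
    have "s (r n) = m" if "n \<ge> N" for n
      using N[OF that] s(2) by auto
    then have "s (r N) = s (r (Suc N))" by simp
    then have "r N = r (Suc N)" using s(1) by (simp add: inj_eq)
    then show False using r by (simp add: strict_mono_eq)
  qed
  then show "U \<in> opens_of (finest_converging X \<A> lp)"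
    using U(2) by (simp add: opens_of_def openin_finest_converging)
qed

theorem theorem1:
  fixes X :: "'a set" and \<tau> :: "'a topology"
  assumes "topspace \<tau> = X"
    and "seq_compact_space \<tau>"
  shows "\<exists>\<tau>'' :: 'a topology. opens_of \<tau> \<subseteq> opens_of \<tau>'' \<and> maximal_seq_compact X \<tau>''"
proof -
  let ?F = "{B. infinite B \<and> B \<subseteq> X \<and> (\<exists>l. set_converges \<tau> B l)}"
  obtain \<A> where \<A>: "\<A> \<subseteq> ?F" "almost_disjoint \<A>"
    and meet: "\<And>B. B \<in> ?F \<Longrightarrow> \<exists>A\<in>\<A>. infinite (B \<inter> A)"
    using maximal_almost_disjoint_subfamily[of ?F] by blast
  have sub: "A \<subseteq> X" if "A \<in> \<A>" for A using \<A>(1) that by blast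
  have "\<forall>A\<in>\<A>. \<exists>l. set_converges \<tau> A l" using \<A>(1) by blast
  then obtain lp where lp: "\<And>A. A \<in> \<A> \<Longrightarrow> set_converges \<tau> A (lp A)" by metis
  let ?T = "finest_converging X \<A> lp"
  have "opens_of \<tau> \<subseteq> opens_of ?T"
  proof
    fix U assume "U \<in> opens_of \<tau>"
    then have U: "openin \<tau> U" by (simp add: opens_of_def)
    have "finite (A - U)" if "A \<in> \<A>" "lp A \<in> U" for A
      using lp[OF that(1)] U that(2) by (simp add: set_converges_def)
    then show "U \<in> opens_of ?T"
      using openin_subset[OF U] assms(1) by (simp add: opens_of_def openin_finest_converging)
  qed
  moreover have "topspace ?T = X" by (rule topspace_finest_converging[OF sub])
  moreover have "seq_compact_space ?T"
    unfolding assms(1)[symmetric]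
  proof (rule seq_compact_space_finest_converging[OF assms(2)])
    show "A \<subseteq> topspace \<tau>" if "A \<in> \<A>" for A using sub[OF that] assms(1) by simp
    show "lp A \<in> topspace \<tau>" if "A \<in> \<A>" for A
      using lp[OF that] by (simp add: set_converges_def)
    show "\<exists>A\<in>\<A>. infinite (B \<inter> A)"
      if "infinite B" "B \<subseteq> topspace \<tau>" "set_converges \<tau> B l" for B l
      using meet[of B] that assms(1) by blast
  qed
  moreover have "\<not> opens_of ?T \<subset> opens_of S" if "topspace S = X" "seq_compact_space S" for S
    using no_finer_seq_compact_space[OF \<A>(2) sub that] by blast
  ultimately show ?thesis unfolding maximal_seq_compact_def by blast
qed

end
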